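(* Let $(M,g)$ be a projectively flat 4-dimensional spacetime (i.e. its projective curvature tensor $P_{hijk}$ vanishes identically) which, together with a perfect fluid stress-energy tensor $T_{ij}=p\,h_{ij}+\rho\,u_iu_j$, is a solution of the $F(R)$-gravity field equations $$F_R(R)R_{ij}-\tfrac12F(R)g_{ij}+(g_{ij}\Box-\nabla_i\nabla_j)F_R(R)=\kappa^2T_{ij}.$$ Then the energy density $\rho$ and the isotropic pressure $p$ are constant on $M$ and satisfy $$p=\frac{RF_R(R)}{4\kappa^2}-\frac{F(R)}{2\kappa^2},\qquad \rho=\frac{F(R)}{2\kappa^2}-\frac{RF_R(R)}{4\kappa^2}.$$
   Context: A spacetime is a connected smooth 4-dimensional Lorentzian manifold $(M,g)$ of signature $(-,+,+,+)$ with Levi-Civita connection $\nabla$, Riemann tensor $R_{hijk}$, Ricci tensor $R_{ij}=g^{hk}R_{hikj}$ and Ricci scalar $R=g^{ij}R_{ij}$; $\Box=\nabla^k\nabla_k$. The projective curvature tensor in dimension $n=4$ is $$P_{hijk}=R_{hijk}+\tfrac{1}{3}\left(R_{ij}g_{hk}-R_{ik}g_{jh}\right).$$ $F$ is a smooth real function of one variable, $F_R=dF/dR$ is its derivative, and $\kappa\neq0$ is a constant. In the perfect fluid stress-energy tensor, $p$ (isotropic pressure) and $\rho$ (energy density) are smooth functions, $u^i$ is a smooth unit timelike vector field, $u_iu^i=-1$, and $h_{ij}=g_{ij}+u_iu_j$. *)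

theory Defs
  imports "HOL-Analysis.Analysis"
begin

section \<open>Smooth maps on open subsets of normed spaces\<close>

text \<open>Only used for open \<open>S\<close> in finite-dimensional spaces, where demanding continuous iterated
  directional derivatives in all directions is the usual notion of class \<open>C\<^sup>k\<close>.\<close>

primrec Ck_on :: "nat \<Rightarrow> 'a::real_normed_vector set \<Rightarrow> ('a \<Rightarrow> 'b::real_normed_vector) \<Rightarrow> bool" where
  "Ck_on 0 S f \<longleftrightarrow> continuous_on S f"
| "Ck_on (Suc k) S f \<longleftrightarrow>
     (\<forall>x\<in>S. f differentiable at x) \<and>
     (\<forall>v. Ck_on k S (\<lambda>x. frechet_derivative f (at x) v))"

definition smooth_on :: "'a::real_normed_vector set \<Rightarrow> ('a \<Rightarrow> 'b::real_normed_vector) \<Rightarrow> bool" where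
  "smooth_on S f \<longleftrightarrow> (\<forall>k. Ck_on k S f)"


section \<open>Smooth 4-manifolds\<close>

text \<open>A chart is a pair of its domain and its coordinate map (arbitrary outside the domain).\<close>

type_synonym 'a chart = "'a set \<times> ('a \<Rightarrow> real^4)"

definition is_chart :: "'a topology \<Rightarrow> 'a chart \<Rightarrow> bool" where
  "is_chart X c \<longleftrightarrow>
     openin X (fst c) \<and> open (snd c ` fst c) \<and>
     homeomorphic_map (subtopology X (fst c)) (top_of_set (snd c ` fst c)) (snd c)"

definition chart_inv :: "'a chart \<Rightarrow> real^4 \<Rightarrow> 'a" where
  "chart_inv c = inv_into (fst c) (snd c)"

definition smooth_atlas :: "'a topology \<Rightarrow> 'a chart set \<Rightarrow> bool" where
  "smooth_atlas X A \<longleftrightarrow>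
     (\<forall>c\<in>A. is_chart X c) \<and> (\<Union>c\<in>A. fst c) = topspace X \<and>
     (\<forall>c\<in>A. \<forall>d\<in>A. smooth_on (snd c ` (fst c \<inter> fst d)) (snd d \<circ> chart_inv c))"

definition smooth_manifold4 :: "'a topology \<Rightarrow> 'a chart set \<Rightarrow> bool" where
  "smooth_manifold4 X A \<longleftrightarrow>
     Hausdorff_space X \<and> second_countable X \<and> smooth_atlas X A"

text \<open>Smoothness of a function on the domain of the chart \<open>c\<close>, read in the coordinates of \<open>c\<close>.\<close>

definition smooth_in :: "'a chart \<Rightarrow> ('a \<Rightarrow> real) \<Rightarrow> bool" where
  "smooth_in c f \<longleftrightarrow> smooth_on (snd c ` fst c) (f \<circ> chart_inv c)"

definition smooth_scalar :: "'a chart set \<Rightarrow> ('a \<Rightarrow> real) \<Rightarrow> bool" where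
  "smooth_scalar A f \<longleftrightarrow> (\<forall>c\<in>A. smooth_in c f)"

text \<open>\<open>pderiv_in c i f q\<close> is \<open>\<partial>f/\<partial>x\<^sup>i\<close> at the point \<open>q\<close>, where \<open>x\<close> are the coordinates of \<open>c\<close>.\<close>

definition pderiv_in :: "'a chart \<Rightarrow> 4 \<Rightarrow> ('a \<Rightarrow> real) \<Rightarrow> 'a \<Rightarrow> real" where
  "pderiv_in c i f q = frechet_derivative (f \<circ> chart_inv c) (at (snd c q)) (axis i 1)"


section \<open>Tensor fields\<close>

text \<open>As usual in index notation, a tensor field is given by its components in every chart of the
  atlas, subject to the transformation law on overlaps. Components are functions of the point of
  the manifold; only their values on the domain of the chart matter. The matrix
  \<open>jacobian c d q $ i $ j\<close> is \<open>\<partial>y\<^sup>i/\<partial>x\<^sup>j\<close> for the coordinates \<open>x\<close> of \<open>c\<close> and \<open>y\<close> of \<open>d\<close>.\<close>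

definition jacobian :: "'a chart \<Rightarrow> 'a chart \<Rightarrow> 'a \<Rightarrow> real^4^4" where
  "jacobian c d q = (\<chi> i j. pderiv_in c j (\<lambda>r. snd d r $ i) q)"

definition vector_field :: "'a chart set \<Rightarrow> ('a chart \<Rightarrow> 'a \<Rightarrow> real^4) \<Rightarrow> bool" where
  "vector_field A u \<longleftrightarrow>
     (\<forall>c\<in>A. \<forall>i. smooth_in c (\<lambda>q. u c q $ i)) \<and>
     (\<forall>c\<in>A. \<forall>d\<in>A. \<forall>q\<in>fst c \<inter> fst d. \<forall>i.
        u d q $ i = (\<Sum>j\<in>UNIV. jacobian c d q $ i $ j * u c q $ j))"

definition covariant2_field :: "'a chart set \<Rightarrow> ('a chart \<Rightarrow> 'a \<Rightarrow> real^4^4) \<Rightarrow> bool" where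
  "covariant2_field A t \<longleftrightarrow>
     (\<forall>c\<in>A. \<forall>i j. smooth_in c (\<lambda>q. t c q $ i $ j)) \<and>
     (\<forall>c\<in>A. \<forall>d\<in>A. \<forall>q\<in>fst c \<inter> fst d. \<forall>i j.
        t c q $ i $ j = (\<Sum>k\<in>UNIV. \<Sum>l\<in>UNIV.
          t d q $ k $ l * jacobian c d q $ k $ i * jacobian c d q $ l $ j))"


section \<open>Lorentzian metrics and spacetimes\<close>

text \<open>The index type \<open>4\<close> has the elements \<open>0, 1, 2, 3\<close>; index \<open>0\<close> is the timelike one.\<close>

definition minkowski :: "real^4^4" where
  "minkowski = (\<chi> i j. if i = j then (if i = 0 then - 1 else 1) else 0)"

text \<open>Symmetric bilinear form of signature \<open>(-,+,+,+)\<close>: the columns of \<open>E\<close> are an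
  orthonormal basis.\<close>

definition lorentzian_form :: "real^4^4 \<Rightarrow> bool" where
  "lorentzian_form G \<longleftrightarrow>
     transpose G = G \<and> (\<exists>E. invertible E \<and> transpose E ** G ** E = minkowski)"

definition lorentzian_metric :: "'a chart set \<Rightarrow> ('a chart \<Rightarrow> 'a \<Rightarrow> real^4^4) \<Rightarrow> bool" where
  "lorentzian_metric A g \<longleftrightarrow>
     covariant2_field A g \<and> (\<forall>c\<in>A. \<forall>q\<in>fst c. lorentzian_form (g c q))"

definition spacetime ::
    "'a topology \<Rightarrow> 'a chart set \<Rightarrow> ('a chart \<Rightarrow> 'a \<Rightarrow> real^4^4) \<Rightarrow> bool" where
  "spacetime X A g \<longleftrightarrow>
     smooth_manifold4 X A \<and> connected_space X \<and> lorentzian_metric A g"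


section \<open>Levi-Civita connection and curvature\<close>

definition ginv :: "('a chart \<Rightarrow> 'a \<Rightarrow> real^4^4) \<Rightarrow> 'a chart \<Rightarrow> 'a \<Rightarrow> real^4^4" where
  "ginv g c q = matrix_inv (g c q)"

text \<open>\<open>christoffel g c k i j\<close> is \<open>\<Gamma>\<^sup>k\<^sub>i\<^sub>j\<close>, the coefficient of the Levi-Civita connection of \<open>g\<close>.\<close>

definition christoffel ::
    "('a chart \<Rightarrow> 'a \<Rightarrow> real^4^4) \<Rightarrow> 'a chart \<Rightarrow> 4 \<Rightarrow> 4 \<Rightarrow> 4 \<Rightarrow> 'a \<Rightarrow> real" where
  "christoffel g c k i j q =
     (1/2) * (\<Sum>l\<in>UNIV. ginv g c q $ k $ l *
        (pderiv_in c i (\<lambda>r. g c r $ j $ l) q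
         + pderiv_in c j (\<lambda>r. g c r $ i $ l) q
         - pderiv_in c l (\<lambda>r. g c r $ i $ j) q))"

text \<open>\<open>riemann_up g c h i j k\<close> is \<open>R\<^sup>h\<^sub>i\<^sub>j\<^sub>k\<close>, with the sign convention
  \<open>\<nabla>\<^sub>j\<nabla>\<^sub>k v\<^sup>h - \<nabla>\<^sub>k\<nabla>\<^sub>j v\<^sup>h = R\<^sup>h\<^sub>i\<^sub>j\<^sub>k v\<^sup>i\<close>.\<close>

definition riemann_up ::
    "('a chart \<Rightarrow> 'a \<Rightarrow> real^4^4) \<Rightarrow> 'a chart \<Rightarrow> 4 \<Rightarrow> 4 \<Rightarrow> 4 \<Rightarrow> 4 \<Rightarrow> 'a \<Rightarrow> real" where
  "riemann_up g c h i j k q =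
     pderiv_in c j (christoffel g c h i k) q - pderiv_in c k (christoffel g c h i j) q
     + (\<Sum>m\<in>UNIV. christoffel g c h j m q * christoffel g c m i k q
                 - christoffel g c h k m q * christoffel g c m i j q)"

definition riemann ::
    "('a chart \<Rightarrow> 'a \<Rightarrow> real^4^4) \<Rightarrow> 'a chart \<Rightarrow> 4 \<Rightarrow> 4 \<Rightarrow> 4 \<Rightarrow> 4 \<Rightarrow> 'a \<Rightarrow> real" where
  "riemann g c h i j k q = (\<Sum>m\<in>UNIV. g c q $ h $ m * riemann_up g c m i j k q)"

definition ricci ::
    "('a chart \<Rightarrow> 'a \<Rightarrow> real^4^4) \<Rightarrow> 'a chart \<Rightarrow> 4 \<Rightarrow> 4 \<Rightarrow> 'a \<Rightarrow> real" where
  "ricci g c i j q = (\<Sum>h\<in>UNIV. \<Sum>k\<in>UNIV. ginv g c q $ h $ k * riemann g c h i k j q)"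

text \<open>The Ricci scalar is computed in the chart \<open>c\<close>; its value at a point is the same in all
  charts of a spacetime around that point.\<close>

definition ricci_scalar ::
    "('a chart \<Rightarrow> 'a \<Rightarrow> real^4^4) \<Rightarrow> 'a chart \<Rightarrow> 'a \<Rightarrow> real" where
  "ricci_scalar g c q = (\<Sum>i\<in>UNIV. \<Sum>j\<in>UNIV. ginv g c q $ i $ j * ricci g c i j q)"

definition projective_curvature ::
    "('a chart \<Rightarrow> 'a \<Rightarrow> real^4^4) \<Rightarrow> 'a chart \<Rightarrow> 4 \<Rightarrow> 4 \<Rightarrow> 4 \<Rightarrow> 4 \<Rightarrow> 'a \<Rightarrow> real" where
  "projective_curvature g c h i j k q =
     riemann g c h i j k q
     + (1/3) * (ricci g c i j q * g c q $ h $ k - ricci g c i k q * g c q $ j $ h)"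

definition projectively_flat :: "'a chart set \<Rightarrow> ('a chart \<Rightarrow> 'a \<Rightarrow> real^4^4) \<Rightarrow> bool" where
  "projectively_flat A g \<longleftrightarrow>
     (\<forall>c\<in>A. \<forall>q\<in>fst c. \<forall>h i j k. projective_curvature g c h i j k q = 0)"

text \<open>\<open>nabla_covector g c \<omega> i j\<close> is \<open>\<nabla>\<^sub>i \<omega>\<^sub>j\<close>, for the components \<open>\<omega>\<close> of a covector field in \<open>c\<close>.\<close>

definition nabla_covector ::
    "('a chart \<Rightarrow> 'a \<Rightarrow> real^4^4) \<Rightarrow> 'a chart \<Rightarrow> (4 \<Rightarrow> 'a \<Rightarrow> real) \<Rightarrow> 4 \<Rightarrow> 4 \<Rightarrow> 'a \<Rightarrow> real" where
  "nabla_covector g c \<omega> i j q =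
     pderiv_in c i (\<omega> j) q - (\<Sum>k\<in>UNIV. christoffel g c k i j q * \<omega> k q)"

definition nabla_nabla ::
    "('a chart \<Rightarrow> 'a \<Rightarrow> real^4^4) \<Rightarrow> 'a chart \<Rightarrow> 4 \<Rightarrow> 4 \<Rightarrow> ('a \<Rightarrow> real) \<Rightarrow> 'a \<Rightarrow> real" where
  "nabla_nabla g c i j f q = nabla_covector g c (\<lambda>k. pderiv_in c k f) i j q"

definition box_op ::
    "('a chart \<Rightarrow> 'a \<Rightarrow> real^4^4) \<Rightarrow> 'a chart \<Rightarrow> ('a \<Rightarrow> real) \<Rightarrow> 'a \<Rightarrow> real" where
  "box_op g c f q = (\<Sum>k\<in>UNIV. \<Sum>l\<in>UNIV. ginv g c q $ k $ l * nabla_nabla g c k l f q)"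


section \<open>Perfect fluids and the field equations of F(R)-gravity\<close>

definition lower ::
    "('a chart \<Rightarrow> 'a \<Rightarrow> real^4^4) \<Rightarrow> ('a chart \<Rightarrow> 'a \<Rightarrow> real^4) \<Rightarrow> 'a chart \<Rightarrow> 4 \<Rightarrow> 'a \<Rightarrow> real" where
  "lower g u c i q = (\<Sum>j\<in>UNIV. g c q $ i $ j * u c q $ j)"

definition unit_timelike_field ::
    "'a chart set \<Rightarrow> ('a chart \<Rightarrow> 'a \<Rightarrow> real^4^4) \<Rightarrow> ('a chart \<Rightarrow> 'a \<Rightarrow> real^4) \<Rightarrow> bool" where
  "unit_timelike_field A g u \<longleftrightarrow>
     vector_field A u \<and>
     (\<forall>c\<in>A. \<forall>q\<in>fst c. (\<Sum>i\<in>UNIV. lower g u c i q * u c q $ i) = - 1)"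

definition perfect_fluid ::
    "('a chart \<Rightarrow> 'a \<Rightarrow> real^4^4) \<Rightarrow> ('a chart \<Rightarrow> 'a \<Rightarrow> real^4) \<Rightarrow> ('a \<Rightarrow> real) \<Rightarrow> ('a \<Rightarrow> real)
      \<Rightarrow> 'a chart \<Rightarrow> 4 \<Rightarrow> 4 \<Rightarrow> 'a \<Rightarrow> real" where
  "perfect_fluid g u p \<rho> c i j q =
     p q * (g c q $ i $ j + lower g u c i q * lower g u c j q)
     + \<rho> q * (lower g u c i q * lower g u c j q)"

definition FR_field_equations ::
    "'a chart set \<Rightarrow> ('a chart \<Rightarrow> 'a \<Rightarrow> real^4^4) \<Rightarrow> (real \<Rightarrow> real) \<Rightarrow> real
      \<Rightarrow> ('a chart \<Rightarrow> 4 \<Rightarrow> 4 \<Rightarrow> 'a \<Rightarrow> real) \<Rightarrow> bool" where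
  "FR_field_equations A g F \<kappa> T \<longleftrightarrow>
     (\<forall>c\<in>A. \<forall>q\<in>fst c. \<forall>i j.
        deriv F (ricci_scalar g c q) * ricci g c i j q
        - (1/2) * F (ricci_scalar g c q) * g c q $ i $ j
        + (g c q $ i $ j * box_op g c (\<lambda>r. deriv F (ricci_scalar g c r)) q
           - nabla_nabla g c i j (\<lambda>r. deriv F (ricci_scalar g c r)) q)
        = \<kappa>\<^sup>2 * T c i j q)"

end

theory Submission
  imports Defs
begin

text \<open>Lowering the first index, projective flatness makes \<open>R\<^sub>h\<^sub>i\<^sub>j\<^sub>k\<close> a combination of \<open>R\<^sub>i\<^sub>k g\<^sub>h\<^sub>j\<close> and
  \<open>R\<^sub>i\<^sub>j g\<^sub>h\<^sub>k\<close>; antisymmetry in \<open>h\<close>, \<open>i\<close> then forces \<open>R\<^sub>i\<^sub>j = (R/4) g\<^sub>i\<^sub>j\<close> and constant-curvature form,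
  and the second Bianchi identity makes \<open>R\<close> locally constant in each chart (Schur). So all
  derivatives of \<open>F\<^sub>R(R)\<close> vanish and the field equations read
  \<open>(R F\<^sub>R/4 - F/2) g\<^sub>i\<^sub>j = \<kappa>\<^sup>2 (p g\<^sub>i\<^sub>j + (p + \<rho>) u\<^sub>i u\<^sub>j)\<close>. Contracting once with \<open>u\<^sup>i u\<^sup>j\<close> and once with
  \<open>g\<^sup>i\<^sup>j\<close> gives \<open>p + \<rho> = 0\<close> and the two formulas. Since \<open>p\<close> does not refer to a chart, its local
  constancy and connectedness make it constant; chart independence of \<open>R\<close> is never needed.\<close>

section \<open>Calculus of smooth functions\<close>

text \<open>A derivative at a point sees only values nearby, and \<open>S\<close> is open, so
  agreement on \<open>S\<close> passes to the derivatives. The induction therefore runs over all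
  pairs \<open>f\<close>, \<open>g\<close>.\<close>

lemma Ck_on_cong:
  assumes "open S" and "\<And>x. x \<in> S \<Longrightarrow> f x = g x" and "Ck_on k S f"
  shows "Ck_on k S g"
  using assms(2,3)
proof (induction k arbitrary: f g)
  case 0
  then show ?case by (metis Ck_on.simps(1) continuous_on_cong)
next
  case (Suc k)
  have *: "frechet_derivative f (at x) = frechet_derivative g (at x)" if "x \<in> S" for x
    using frechet_derivative_transform_within_open[of f x S g] Suc.prems assms(1) that by auto
  have "g differentiable at x" if "x \<in> S" for x
    using Suc.prems assms(1) that has_derivative_transform_within_open[of f _ x UNIV S g]
    unfolding differentiable_def by (metis Ck_on.simps(2) differentiable_def)
  moreover have "Ck_on k S (\<lambda>x. frechet_derivative g (at x) v)" for v
    using Suc.IH[of "\<lambda>x. frechet_derivative f (at x) v" "\<lambda>x. frechet_derivative g (at x) v"]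
      Suc.prems * by auto
  ultimately show ?case by simp
qed

lemma Ck_on_SucD: "Ck_on (Suc k) S f \<Longrightarrow> Ck_on k S f"
proof (induction k arbitrary: f)
  case 0
  then show ?case
    by (auto intro!: continuous_at_imp_continuous_on differentiable_imp_continuous_within)
next
  case (Suc k)
  have "\<forall>v. Ck_on k S (\<lambda>x. frechet_derivative f (at x) v)"
    using Suc.IH Suc.prems by (metis Ck_on.simps(2))
  then show ?case using Suc.prems by simp
qed

lemma Ck_on_const: "Ck_on k S (\<lambda>x. a)"
  by (induction k arbitrary: a) auto

lemma frechet_derivative_eq:
  "(f has_derivative f') (at x) \<Longrightarrow> frechet_derivative f (at x) v = f' v"
  by (simp add: frechet_derivative_at[symmetric])

lemma frechet_derivative_add:
  assumes "f differentiable at x" "g differentiable at x"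
  shows "frechet_derivative (\<lambda>x. f x + g x) (at x) v =
    frechet_derivative f (at x) v + frechet_derivative g (at x) v"
  using assms
  by (intro frechet_derivative_eq) (auto intro!: derivative_eq_intros simp: frechet_derivative_works)

lemma frechet_derivative_mult:
  fixes f g :: "'a::real_normed_vector \<Rightarrow> real"
  assumes "f differentiable at x" "g differentiable at x"
  shows "frechet_derivative (\<lambda>x. f x * g x) (at x) v =
    f x * frechet_derivative g (at x) v + frechet_derivative f (at x) v * g x"
  using assms
  by (intro frechet_derivative_eq) (auto intro!: has_derivative_mult simp: frechet_derivative_works)

text \<open>The derivative is written as a product of a constant, a derivative and copies of
  \<open>inverse (f x)\<close>, so that the product and constant rules for \<open>Ck_on\<close>
  apply to it as it stands.\<close>

lemma frechet_derivative_inverse: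
  fixes f :: "'a::real_normed_vector \<Rightarrow> real"
  assumes "f differentiable at x" "f x \<noteq> 0"
  shows "frechet_derivative (\<lambda>x. inverse (f x)) (at x) v =
    - 1 * (frechet_derivative f (at x) v * (inverse (f x) * inverse (f x)))"
  using assms
  by (intro frechet_derivative_eq)
    (auto intro!: derivative_eq_intros simp: frechet_derivative_works[symmetric])

lemma Ck_on_add:
  assumes "open S" and "Ck_on k S f" and "Ck_on k S g"
  shows "Ck_on k S (\<lambda>x. f x + g x)"
  using assms(2,3)
proof (induction k arbitrary: f g)
  case 0
  then show ?case by (simp add: continuous_on_add)
next
  case (Suc k)
  have "Ck_on k S (\<lambda>x. frechet_derivative (\<lambda>x. f x + g x) (at x) v)" for v
    by (rule Ck_on_cong[OF assms(1) _ Suc.IH[of "\<lambda>x. frechet_derivative f (at x) v"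
        "\<lambda>x. frechet_derivative g (at x) v"]])
      (use Suc.prems in \<open>auto simp: frechet_derivative_add\<close>)
  then show ?case using Suc.prems by auto
qed

lemma Ck_on_mult:
  fixes f g :: "'a::real_normed_vector \<Rightarrow> real"
  assumes "open S" and "Ck_on k S f" and "Ck_on k S g"
  shows "Ck_on k S (\<lambda>x. f x * g x)"
  using assms(2,3)
proof (induction k arbitrary: f g)
  case 0
  then show ?case by (simp add: continuous_on_mult)
next
  case (Suc k)
  \<comment> \<open>The product rule also contains the undifferentiated factors, so these are needed
    at order \<open>k\<close> as well.\<close>
  have "Ck_on k S f" "Ck_on k S g"
    using Suc.prems Ck_on_SucD by blast+
  then have "Ck_on k S (\<lambda>x. f x * frechet_derivative g (at x) v + frechet_derivative f (at x) v * g x)" for v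
    using Suc by (intro Ck_on_add[OF assms(1)] Suc.IH) auto
  then have "Ck_on k S (\<lambda>x. frechet_derivative (\<lambda>x. f x * g x) (at x) v)" for v
    by (rule Ck_on_cong[OF assms(1), rotated])
      (use Suc.prems in \<open>auto simp: frechet_derivative_mult\<close>)
  then show ?case using Suc.prems by auto
qed

text \<open>The derivative of \<open>1/f\<close> is a polynomial in \<open>1/f\<close> and the
  derivative of \<open>f\<close>, so the induction hypothesis for this same \<open>f\<close>
  suffices.\<close>

lemma Ck_on_inverse:
  fixes f :: "'a::real_normed_vector \<Rightarrow> real"
  assumes "open S" and "\<And>x. x \<in> S \<Longrightarrow> f x \<noteq> 0" and "Ck_on k S f"
  shows "Ck_on k S (\<lambda>x. inverse (f x))"
  using assms(3)
proof (induction k)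
  case 0
  then show ?case by (simp add: assms(2) continuous_on_inverse)
next
  case (Suc k)
  have "Ck_on k S (\<lambda>x. inverse (f x))"
    using Suc Ck_on_SucD by blast
  then have "Ck_on k S (\<lambda>x. - 1 * (frechet_derivative f (at x) v * (inverse (f x) * inverse (f x))))" for v
    using Suc by (intro Ck_on_mult[OF assms(1)] Ck_on_const) auto
  then have "Ck_on k S (\<lambda>x. frechet_derivative (\<lambda>x. inverse (f x)) (at x) v)" for v
    by (rule Ck_on_cong[OF assms(1), rotated])
      (use Suc.prems assms(2) in \<open>simp add: frechet_derivative_inverse\<close>)
  then show ?case using Suc.prems assms(2) by (auto intro!: differentiable_inverse)
qed

lemma smooth_on_const: "smooth_on S (\<lambda>x. a)"
  by (simp add: smooth_on_def Ck_on_const)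

lemma smooth_on_add: "open S \<Longrightarrow> smooth_on S f \<Longrightarrow> smooth_on S g \<Longrightarrow> smooth_on S (\<lambda>x. f x + g x)"
  by (simp add: smooth_on_def Ck_on_add)

lemma smooth_on_mult:
  fixes f g :: "'a::real_normed_vector \<Rightarrow> real"
  shows "open S \<Longrightarrow> smooth_on S f \<Longrightarrow> smooth_on S g \<Longrightarrow> smooth_on S (\<lambda>x. f x * g x)"
  by (simp add: smooth_on_def Ck_on_mult)

lemma smooth_on_inverse:
  fixes f :: "'a::real_normed_vector \<Rightarrow> real"
  shows "open S \<Longrightarrow> (\<And>x. x \<in> S \<Longrightarrow> f x \<noteq> 0) \<Longrightarrow> smooth_on S f \<Longrightarrow> smooth_on S (\<lambda>x. inverse (f x))"
  by (simp add: smooth_on_def Ck_on_inverse)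

lemma smooth_on_cong:
  "open S \<Longrightarrow> (\<And>x. x \<in> S \<Longrightarrow> f x = g x) \<Longrightarrow> smooth_on S f \<Longrightarrow> smooth_on S g"
  unfolding smooth_on_def using Ck_on_cong by metis

lemma smooth_on_frechet_derivative:
  "smooth_on S f \<Longrightarrow> smooth_on S (\<lambda>x. frechet_derivative f (at x) v)"
  by (metis smooth_on_def Ck_on.simps(2))

lemma smooth_on_differentiable:
  "smooth_on S f \<Longrightarrow> x \<in> S \<Longrightarrow> f differentiable at x"
  by (metis smooth_on_def Ck_on.simps(2))

lemma smooth_on_continuous: "smooth_on S f \<Longrightarrow> continuous_on S f"
  by (metis smooth_on_def Ck_on.simps(1))

section \<open>Symmetry of mixed second derivatives\<close>

lemma has_real_derivative_along_line:
  fixes f :: "'a::real_normed_vector \<Rightarrow> real"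
  assumes "f differentiable at (y + s *\<^sub>R v)"
  shows "((\<lambda>s. f (y + s *\<^sub>R v)) has_real_derivative frechet_derivative f (at (y + s *\<^sub>R v)) v) (at s)"
proof -
  let ?D = "frechet_derivative f (at (y + s *\<^sub>R v))"
  have D: "(f has_derivative ?D) (at (y + s *\<^sub>R v))"
    using assms by (simp add: frechet_derivative_works)
  have "((\<lambda>s. f (y + s *\<^sub>R v)) has_derivative (\<lambda>h. ?D (h *\<^sub>R v))) (at s)"
    by (rule has_derivative_compose[where f = "\<lambda>s. y + s *\<^sub>R v", OF _ D])
      (auto intro!: derivative_eq_intros)
  moreover have "(\<lambda>h. ?D (h *\<^sub>R v)) = (*) (?D v)"
    using linear_scale[OF has_derivative_linear[OF D]] by (auto simp: mult.commute)
  ultimately show ?thesis by (simp add: has_field_derivative_def)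
qed

text \<open>Two applications of the mean value theorem, first along \<open>v\<close> and then along
  \<open>w\<close>, turn the second difference into \<open>h * h * D y\<close> for some
  \<open>y\<close> in the parallelogram at \<open>x\<close> spanned by \<open>h *\<^sub>R v\<close>
  and \<open>h *\<^sub>R w\<close>. Continuity of \<open>D\<close> at \<open>x\<close> bounds the
  error.\<close>

lemma second_difference_approx:
  fixes f :: "'a::real_normed_vector \<Rightarrow> real" and v w :: 'a
  assumes "open S" "smooth_on S f" "x \<in> S" "e > 0"
  defines "D \<equiv> \<lambda>y. frechet_derivative (\<lambda>z. frechet_derivative f (at z) v) (at y) w"
  shows "\<exists>d>0. \<forall>h. 0 < h \<and> h < d \<longrightarrow>
    \<bar>f (x + h *\<^sub>R v + h *\<^sub>R w) - f (x + h *\<^sub>R v) - f (x + h *\<^sub>R w) + f x - h * h * D x\<bar> \<le> h * h * e"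
proof -
  have "continuous_on S D"
    unfolding D_def using assms(2) by (intro smooth_on_continuous smooth_on_frechet_derivative)
  then have "open S \<and> isCont D x" using assms(1,3) continuous_on_eq_continuous_at by blast
  then obtain r1 where r1: "r1 > 0" "\<And>y. dist y x < r1 \<Longrightarrow> \<bar>D y - D x\<bar> < e"
    using assms(4) unfolding continuous_at_eps_delta dist_real_def by (metis dist_commute)
  obtain r2 where r2: "r2 > 0" "ball x r2 \<subseteq> S"
    using assms(1,3) openE by blast
  define r where "r = min r1 r2"
  \<comment> \<open>For \<open>h < d\<close> the whole parallelogram lies within distance
    \<open>r\<close> of \<open>x\<close>; the summand 1 keeps the denominator positive when
    \<open>v\<close> and \<open>w\<close> vanish.\<close>
  define d where "d = r / (norm v + norm w + 1)"
  have pos: "norm v + norm w + 1 > 0" by (smt (verit) norm_ge_zero)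
  have "d > 0" using r1 r2 pos by (simp add: d_def r_def)
  have near: "dist (x + a *\<^sub>R v + b *\<^sub>R w) x < r" if "0 \<le> a" "a \<le> h" "0 \<le> b" "b \<le> h" "h < d" for a b h
  proof -
    have "norm (a *\<^sub>R v + b *\<^sub>R w) \<le> h * norm v + h * norm w"
      using that by (intro norm_triangle_mono) (auto intro!: mult_right_mono)
    also have "\<dots> \<le> h * (norm v + norm w + 1)" using that by (simp add: algebra_simps)
    also have "\<dots> < d * (norm v + norm w + 1)" using that pos by (intro mult_strict_right_mono)
    also have "\<dots> = r" using pos by (simp add: d_def)
    finally show ?thesis by (simp add: dist_norm add.assoc)
  qed
  have inS: "x + a *\<^sub>R v + b *\<^sub>R w \<in> S" if "0 \<le> a" "a \<le> h" "0 \<le> b" "b \<le> h" "h < d" for a b h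
    using near[OF that] r2 by (auto simp: r_def dist_commute)
  have "\<bar>f (x + h *\<^sub>R v + h *\<^sub>R w) - f (x + h *\<^sub>R v) - f (x + h *\<^sub>R w) + f x - h * h * D x\<bar> \<le> h * h * e"
    if h: "0 < h" "h < d" for h
  proof -
    let ?Dv = "\<lambda>y. frechet_derivative f (at y) v"
    have 1: "((\<lambda>s. f (x + h *\<^sub>R w + s *\<^sub>R v) - f (x + s *\<^sub>R v)) has_real_derivative
        ?Dv (x + h *\<^sub>R w + s *\<^sub>R v) - ?Dv (x + s *\<^sub>R v)) (at s)" if "0 \<le> s" "s \<le> h" for s
    proof (intro DERIV_diff has_real_derivative_along_line smooth_on_differentiable[OF assms(2)])
      show "x + h *\<^sub>R w + s *\<^sub>R v \<in> S" using inS[of s h h] that h by (simp add: algebra_simps)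
      show "x + s *\<^sub>R v \<in> S" using inS[of s h 0] that h by simp
    qed
    obtain a where a: "0 < a" "a < h"
      "f (x + h *\<^sub>R w + h *\<^sub>R v) - f (x + h *\<^sub>R v) - (f (x + h *\<^sub>R w) - f x) =
        h * (?Dv (x + h *\<^sub>R w + a *\<^sub>R v) - ?Dv (x + a *\<^sub>R v))"
      using MVT2[OF h(1) 1] by auto
    have 2: "((\<lambda>t. ?Dv (x + a *\<^sub>R v + t *\<^sub>R w)) has_real_derivative D (x + a *\<^sub>R v + t *\<^sub>R w)) (at t)"
      if "0 \<le> t" "t \<le> h" for t
      unfolding D_def
      using inS[of a h t] that h a assms(2)
      by (intro has_real_derivative_along_line smooth_on_differentiable[OF smooth_on_frechet_derivative]) auto
    obtain b where b: "0 < b" "b < h"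
      "?Dv (x + a *\<^sub>R v + h *\<^sub>R w) - ?Dv (x + a *\<^sub>R v) = h * D (x + a *\<^sub>R v + b *\<^sub>R w)"
      using MVT2[OF h(1) 2] by auto
    let ?y = "x + a *\<^sub>R v + b *\<^sub>R w"
    have eq: "f (x + h *\<^sub>R v + h *\<^sub>R w) - f (x + h *\<^sub>R v) - f (x + h *\<^sub>R w) + f x - h * h * D x
        = h * h * (D ?y - D x)"
      using a(3) b(3) by (simp add: algebra_simps)
    have "\<bar>D ?y - D x\<bar> < e"
      using near[of a h b] a b h by (intro r1) (auto simp: r_def)
    then have "\<bar>h * h * (D ?y - D x)\<bar> \<le> h * h * e"
      by (simp add: abs_mult mult_left_mono)
    then show ?thesis unfolding eq .
  qed
  then show ?thesis using \<open>d > 0\<close> by blast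
qed

text \<open>The second difference is symmetric in \<open>v\<close> and \<open>w\<close>, and divided
  by \<open>h * h\<close> it approximates both mixed derivatives.\<close>

lemma smooth_on_mixed_derivatives_commute:
  fixes f :: "'a::real_normed_vector \<Rightarrow> real"
  assumes "open S" "smooth_on S f" "x \<in> S"
  shows "frechet_derivative (\<lambda>z. frechet_derivative f (at z) v) (at x) w =
    frechet_derivative (\<lambda>z. frechet_derivative f (at z) w) (at x) v" (is "?a = ?b")
proof (rule ccontr)
  assume "?a \<noteq> ?b"
  \<comment> \<open>The two errors add up to at most \<open>2 * e\<close>, which is less than the
    supposed gap \<open>3 * e\<close>.\<close>
  define e where "e = \<bar>?a - ?b\<bar> / 3"
  have e: "e > 0" using \<open>?a \<noteq> ?b\<close> by (simp add: e_def)
  obtain d1 where d1: "d1 > 0" "\<And>h. 0 < h \<Longrightarrow> h < d1 \<Longrightarrow>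
    \<bar>f (x + h *\<^sub>R v + h *\<^sub>R w) - f (x + h *\<^sub>R v) - f (x + h *\<^sub>R w) + f x - h * h * ?a\<bar> \<le> h * h * e"
    using second_difference_approx[OF assms e, of v w] by blast
  obtain d2 where d2: "d2 > 0" "\<And>h. 0 < h \<Longrightarrow> h < d2 \<Longrightarrow>
    \<bar>f (x + h *\<^sub>R w + h *\<^sub>R v) - f (x + h *\<^sub>R w) - f (x + h *\<^sub>R v) + f x - h * h * ?b\<bar> \<le> h * h * e"
    using second_difference_approx[OF assms e, of w v] by blast
  obtain h where h: "0 < h" "h < d1" "h < d2"
    using d1(1) d2(1) by (metis dense min_less_iff_conj)
  have "x + h *\<^sub>R w + h *\<^sub>R v = x + h *\<^sub>R v + h *\<^sub>R w" by simp
  then have "\<bar>h * h * ?a - h * h * ?b\<bar> \<le> 2 * (h * h * e)"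
    using d1(2)[of h] d2(2)[of h] h by (smt (verit))
  then have "h * h * \<bar>?a - ?b\<bar> \<le> h * h * (2 * e)"
    using h by (simp add: abs_mult right_diff_distrib[symmetric])
  then have "\<bar>?a - ?b\<bar> \<le> 2 * e"
    using h mult_le_cancel_left_pos[of "h * h"] by simp
  then show False using e by (simp add: e_def)
qed

section \<open>Calculus in a chart\<close>

lemma is_chart_open: "is_chart X c \<Longrightarrow> open (snd c ` fst c)"
  by (simp add: is_chart_def)

lemma is_chart_openin: "is_chart X c \<Longrightarrow> openin X (fst c)"
  by (simp add: is_chart_def)

lemma is_chart_inj: "is_chart X c \<Longrightarrow> inj_on (snd c) (fst c)"
  unfolding is_chart_def
  by (metis homeomorphic_imp_injective_map openin_subset topspace_subtopology_subset)

lemma chart_inv_left: "is_chart X c \<Longrightarrow> q \<in> fst c \<Longrightarrow> chart_inv c (snd c q) = q"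
  unfolding chart_inv_def by (simp add: is_chart_inj)

lemma chart_inv_in: "x \<in> snd c ` fst c \<Longrightarrow> chart_inv c x \<in> fst c"
  unfolding chart_inv_def by (rule inv_into_into)

lemma chart_inv_right: "x \<in> snd c ` fst c \<Longrightarrow> snd c (chart_inv c x) = x"
  unfolding chart_inv_def by (rule f_inv_into_f)

text \<open>This turns open sets of coordinates into open sets of the manifold: the preimage is open
  in the chart domain, which is itself open in \<open>X\<close>.\<close>

lemma openin_chart_vimage:
  assumes "is_chart X c" "open B"
  shows "openin X {r \<in> fst c. snd c r \<in> B}"
proof -
  have top: "topspace (subtopology X (fst c)) = fst c"
    using openin_subset[OF is_chart_openin[OF assms(1)]] by auto
  have "continuous_map (subtopology X (fst c)) (top_of_set (snd c ` fst c)) (snd c)"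
    using assms(1) homeomorphic_imp_continuous_map unfolding is_chart_def by blast
  then have "continuous_map (subtopology X (fst c)) euclidean (snd c)"
    by (simp add: continuous_map_in_subtopology)
  then have "openin (subtopology X (fst c)) {r \<in> topspace (subtopology X (fst c)). snd c r \<in> B}"
    by (rule openin_continuous_map_preimage) (simp add: assms(2))
  then have "openin (subtopology X (fst c)) {r \<in> fst c. snd c r \<in> B}"
    unfolding top .
  then show ?thesis
    by (rule openin_trans_full) (rule is_chart_openin[OF assms(1)])
qed

lemma smooth_in_cong:
  assumes "is_chart X c" "\<And>r. r \<in> fst c \<Longrightarrow> f r = h r" "smooth_in c f"
  shows "smooth_in c h"
  using assms(3) unfolding smooth_in_def
  by (rule smooth_on_cong[OF is_chart_open[OF assms(1)], rotated])
    (simp add: assms(2) chart_inv_in del: image_iff)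

lemma smooth_in_const: "smooth_in c (\<lambda>_. a)"
  by (simp add: smooth_in_def comp_def smooth_on_const)

lemma smooth_in_add:
  "is_chart X c \<Longrightarrow> smooth_in c f \<Longrightarrow> smooth_in c h \<Longrightarrow> smooth_in c (\<lambda>r. f r + h r)"
  unfolding smooth_in_def comp_def by (intro smooth_on_add is_chart_open)

lemma smooth_in_mult:
  "is_chart X c \<Longrightarrow> smooth_in c f \<Longrightarrow> smooth_in c h \<Longrightarrow> smooth_in c (\<lambda>r. f r * h r)"
  unfolding smooth_in_def comp_def by (intro smooth_on_mult is_chart_open)

lemma smooth_in_diff:
  assumes "is_chart X c" "smooth_in c f" "smooth_in c h"
  shows "smooth_in c (\<lambda>r. f r - h r)"
  using smooth_in_add[OF assms(1,2) smooth_in_mult[OF assms(1) smooth_in_const[of c "-1"] assms(3)]]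
  by simp

lemma smooth_in_sum:
  assumes "is_chart X c" "\<And>i. i \<in> I \<Longrightarrow> smooth_in c (f i)"
  shows "smooth_in c (\<lambda>r. \<Sum>i\<in>I. f i r)"
  using assms(2)
  by (induction I rule: infinite_finite_induct) (auto simp: smooth_in_const smooth_in_add[OF assms(1)])

lemma smooth_in_prod:
  assumes "is_chart X c" "\<And>i. i \<in> I \<Longrightarrow> smooth_in c (f i)"
  shows "smooth_in c (\<lambda>r. \<Prod>i\<in>I. f i r)"
  using assms(2)
  by (induction I rule: infinite_finite_induct) (auto simp: smooth_in_const smooth_in_mult[OF assms(1)])

lemma smooth_in_inverse:
  assumes "is_chart X c" "smooth_in c f" "\<And>r. r \<in> fst c \<Longrightarrow> f r \<noteq> 0"
  shows "smooth_in c (\<lambda>r. inverse (f r))"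
  using assms unfolding smooth_in_def comp_def
  by (intro smooth_on_inverse is_chart_open) (auto simp: chart_inv_left)

lemma smooth_in_pderiv_in:
  assumes "is_chart X c" "smooth_in c f"
  shows "smooth_in c (pderiv_in c i f)"
  unfolding smooth_in_def
  by (rule smooth_on_cong[OF is_chart_open[OF assms(1)] _
        smooth_on_frechet_derivative[OF assms(2)[unfolded smooth_in_def], of "axis i 1"]])
    (simp add: pderiv_in_def chart_inv_right)

lemma smooth_in_differentiable:
  "smooth_in c f \<Longrightarrow> q \<in> fst c \<Longrightarrow> (f \<circ> chart_inv c) differentiable at (snd c q)"
  unfolding smooth_in_def by (auto intro: smooth_on_differentiable)

lemma pderiv_in_cong:
  assumes "is_chart X c" "q \<in> fst c" "smooth_in c f" "\<And>r. r \<in> fst c \<Longrightarrow> f r = h r"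
  shows "pderiv_in c i f q = pderiv_in c i h q"
  unfolding pderiv_in_def
  using frechet_derivative_transform_within_open[OF smooth_in_differentiable[OF assms(3,2)]
      is_chart_open[OF assms(1)], of "h \<circ> chart_inv c"]
  by (simp add: assms(2,4) chart_inv_in del: image_iff)

lemma pderiv_in_const: "pderiv_in c i (\<lambda>_. a) q = 0"
  by (simp add: pderiv_in_def comp_def)

lemma pderiv_in_add:
  "q \<in> fst c \<Longrightarrow> smooth_in c f \<Longrightarrow> smooth_in c h \<Longrightarrow>
    pderiv_in c i (\<lambda>r. f r + h r) q = pderiv_in c i f q + pderiv_in c i h q"
  using frechet_derivative_add[OF smooth_in_differentiable smooth_in_differentiable]
  by (simp add: pderiv_in_def comp_def)

lemma pderiv_in_mult:
  assumes "is_chart X c" "q \<in> fst c" "smooth_in c f" "smooth_in c h"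
  shows "pderiv_in c i (\<lambda>r. f r * h r) q = f q * pderiv_in c i h q + pderiv_in c i f q * h q"
  using frechet_derivative_mult[OF smooth_in_differentiable[OF assms(3,2)] smooth_in_differentiable[OF assms(4,2)]]
  by (simp add: pderiv_in_def comp_def chart_inv_left[OF assms(1,2)])

lemma pderiv_in_diff:
  assumes "is_chart X c" "q \<in> fst c" "smooth_in c f" "smooth_in c h"
  shows "pderiv_in c i (\<lambda>r. f r - h r) q = pderiv_in c i f q - pderiv_in c i h q"
  using pderiv_in_add[OF assms(2,3) smooth_in_mult[OF assms(1) smooth_in_const[of c "-1"] assms(4)], of i]
    pderiv_in_mult[OF assms(1,2) smooth_in_const[of c "-1"] assms(4), of i]
  by (simp add: pderiv_in_const)

lemma pderiv_in_sum:
  assumes "is_chart X c" "q \<in> fst c" "\<And>k. k \<in> I \<Longrightarrow> smooth_in c (f k)"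
  shows "pderiv_in c i (\<lambda>r. \<Sum>k\<in>I. f k r) q = (\<Sum>k\<in>I. pderiv_in c i (f k) q)"
  using assms(3)
proof (induction I rule: infinite_finite_induct)
  case (insert j I)
  have "smooth_in c (f j)" "smooth_in c (\<lambda>r. \<Sum>k\<in>I. f k r)"
    using insert.prems by (auto intro: smooth_in_sum[OF assms(1)])
  then show ?case using insert by (simp add: pderiv_in_add[OF assms(2)])
qed (simp_all add: pderiv_in_const)

lemma pderiv_in_commute:
  assumes "is_chart X c" "q \<in> fst c" "smooth_in c f"
  shows "pderiv_in c i (pderiv_in c j f) q = pderiv_in c j (pderiv_in c i f) q"
proof -
  let ?S = "snd c ` fst c" and ?f = "f \<circ> chart_inv c"
  \<comment> \<open>The first partial derivative, read in coordinates, is a directional derivative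
    of \<open>?f\<close> only on the image of the chart; that image is open, so the outer
    derivatives agree.\<close>
  have *: "frechet_derivative (pderiv_in c a f \<circ> chart_inv c) (at (snd c q)) =
      frechet_derivative (\<lambda>x. frechet_derivative ?f (at x) (axis a 1)) (at (snd c q))" for a
  proof (rule frechet_derivative_transform_within_open[where X = ?S])
    show "pderiv_in c a f \<circ> chart_inv c differentiable at (snd c q)"
      by (rule smooth_in_differentiable[OF smooth_in_pderiv_in[OF assms(1,3)] assms(2)])
  qed (use assms(2) is_chart_open[OF assms(1)] in \<open>auto simp: pderiv_in_def chart_inv_right\<close>)
  show ?thesis
    unfolding pderiv_in_def[of c _ "pderiv_in c _ f"] *
    using assms(2) is_chart_open[OF assms(1)] assms(3)[unfolded smooth_in_def]
    by (intro smooth_on_mixed_derivatives_commute[of ?S]) simp_all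
qed

text \<open>This serves to differentiate \<open>F_R(R)\<close>, and then its first derivatives,
  without a chain rule for the composition.\<close>

lemma pderiv_in_locally_const:
  assumes "is_chart X c" "open B" "snd c q \<in> B" "q \<in> fst c"
    and "\<And>r. r \<in> fst c \<Longrightarrow> snd c r \<in> B \<Longrightarrow> f r = a"
  shows "pderiv_in c i f q = 0"
proof -
  have "frechet_derivative (\<lambda>_. a) (at (snd c q)) = frechet_derivative (f \<circ> chart_inv c) (at (snd c q))"
  proof (rule frechet_derivative_transform_within_open)
    show "open (B \<inter> snd c ` fst c)"
      using assms(2) is_chart_open[OF assms(1)] by (rule open_Int)
    show "a = (f \<circ> chart_inv c) x" if "x \<in> B \<inter> snd c ` fst c" for x
      using that by (simp add: assms(5) chart_inv_in chart_inv_right del: image_iff)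
  qed (use assms(3,4) in auto)
  then show ?thesis by (simp add: pderiv_in_def fun_eq_iff)
qed

text \<open>The partial derivatives are the values of the Frechet derivative on the standard basis,
  so the latter vanishes by linearity. On a ball, which is convex, the function is then
  constant.\<close>

lemma pderiv_in_zero_imp_locally_const:
  assumes "is_chart X c" "smooth_in c f" "\<And>r i. r \<in> fst c \<Longrightarrow> pderiv_in c i f r = 0" "q \<in> fst c"
  obtains B where "open B" "snd c q \<in> B" "\<And>r. r \<in> fst c \<Longrightarrow> snd c r \<in> B \<Longrightarrow> f r = f q"
proof -
  let ?S = "snd c ` fst c" and ?f = "f \<circ> chart_inv c"
  obtain e where e: "e > 0" "ball (snd c q) e \<subseteq> ?S"
    by (rule openE[OF is_chart_open[OF assms(1)] imageI[OF assms(4)]])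
  have "(?f has_derivative (\<lambda>h. 0)) (at x)" if "x \<in> ?S" for x
  proof -
    from that obtain r where r: "r \<in> fst c" "x = snd c r" by blast
    have d: "(?f has_derivative frechet_derivative ?f (at x)) (at x)"
      using smooth_in_differentiable[OF assms(2) r(1)] unfolding r(2) frechet_derivative_works .
    have "linear (frechet_derivative ?f (at x))" by (rule has_derivative_linear[OF d])
    moreover have "frechet_derivative ?f (at x) b = 0" if "b \<in> Basis" for b
      using assms(3)[OF r(1)] that r(2) by (auto simp: pderiv_in_def Basis_vec_def)
    ultimately have "frechet_derivative ?f (at x) = (\<lambda>h. 0)"
      using linear_eq_stdbasis[of "frechet_derivative ?f (at x)" "\<lambda>h. 0"]
      by (simp add: linear_zero)
    then show ?thesis using d by simp
  qed
  then have "\<exists>a. \<forall>x\<in>ball (snd c q) e. ?f x = a"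
    using e(2) by (intro has_derivative_zero_constant convex_ball) (blast intro: has_derivative_at_withinI)
  then obtain a where a: "\<And>x. x \<in> ball (snd c q) e \<Longrightarrow> ?f x = a" by blast
  have "f r = f q" if "r \<in> fst c" "snd c r \<in> ball (snd c q) e" for r
    using a[OF that(2)] a[of "snd c q"] e(1) chart_inv_left[OF assms(1)] that assms(4) by simp
  then show ?thesis using that[of "ball (snd c q) e"] e(1) by simp
qed

lemma constant_on_connected_space:
  assumes "connected_space X"
    and "\<And>q. q \<in> topspace X \<Longrightarrow> \<exists>N. openin X N \<and> q \<in> N \<and> (\<forall>r\<in>N. f r = f q)"
  shows "f constant_on topspace X"
proof (cases "topspace X = {}")
  case True
  then show ?thesis by (simp add: constant_on_def)
next
  case False
  then obtain q where q: "q \<in> topspace X" by blast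
  \<comment> \<open>A general \<open>P\<close> gives openness of a level set and of its complement
    at once; connectedness then makes the complement empty.\<close>
  have o: "openin X {r \<in> topspace X. P (f r)}" for P
  proof (subst openin_subopen, safe)
    fix x assume x: "x \<in> topspace X" "P (f x)"
    then obtain N where "openin X N" "x \<in> N" "\<forall>r\<in>N. f r = f x" using assms(2) by blast
    then show "\<exists>T. openin X T \<and> x \<in> T \<and> T \<subseteq> {r \<in> topspace X. P (f r)}"
      using x openin_subset by (intro exI[of _ N]) fastforce
  qed
  have "{r \<in> topspace X. f r \<noteq> f q} = {}"
    using assms(1) o[of "\<lambda>y. y = f q"] o[of "\<lambda>y. y \<noteq> f q"] q
      connected_spaceD[of X "{r \<in> topspace X. f r = f q}" "{r \<in> topspace X. f r \<noteq> f q}"]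
    by auto
  then show ?thesis unfolding constant_on_def by blast
qed

section \<open>Nondegeneracy of the metric and smoothness of its inverse\<close>

lemma lorentzian_form_det: "lorentzian_form G \<Longrightarrow> det G \<noteq> 0"
proof -
  assume "lorentzian_form G"
  then obtain E where "transpose E ** G ** E = minkowski" unfolding lorentzian_form_def by blast
  then have "det (transpose E) * det G * det E = det minkowski" by (metis det_mul)
  moreover have "det minkowski \<noteq> 0"
    by (subst det_diagonal) (auto simp: minkowski_def prod_zero_iff)
  ultimately show ?thesis by auto
qed

lemma matrix_inv_inverse:
  fixes G :: "real^'n^'n"
  assumes "det G \<noteq> 0"
  shows "G ** matrix_inv G = mat 1" "matrix_inv G ** G = mat 1"
proof -
  have "invertible G" using assms invertible_det_nz by blast
  then have "\<exists>H. G ** H = mat 1 \<and> H ** G = mat 1" by (simp add: invertible_def)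
  then have "G ** matrix_inv G = mat 1 \<and> matrix_inv G ** G = mat 1"
    unfolding matrix_inv_def by (rule someI_ex)
  then show "G ** matrix_inv G = mat 1" "matrix_inv G ** G = mat 1" by auto
qed

text \<open>Column \<open>l\<close> of the inverse solves \<open>G *v x = axis l 1\<close>, so
  Cramer's rule applies. The resulting expression in determinants shows that the inverse of a smooth
  invertible matrix is smooth.\<close>

lemma matrix_inv_cramer:
  fixes G :: "real^'n^'n"
  assumes "det G \<noteq> 0"
  shows "matrix_inv G $ k $ l = det (\<chi> i j. if j = k then axis l 1 $ i else G $ i $ j) * inverse (det G)"
proof -
  have "G *v (matrix_inv G *v axis l 1) = axis l 1"
    by (simp add: matrix_vector_mul_assoc matrix_inv_inverse[OF assms])
  then have "matrix_inv G *v axis l 1 =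
      (\<chi> k. det (\<chi> i j. if j = k then axis l 1 $ i else G $ i $ j) / det G)"
    by (simp only: cramer[OF assms])
  then have "(matrix_inv G *v axis l 1) $ k = det (\<chi> i j. if j = k then axis l 1 $ i else G $ i $ j) / det G"
    by simp
  then show ?thesis
    by (simp add: matrix_vector_mul_component inner_axis divide_inverse)
qed

lemma smooth_in_det:
  assumes "is_chart X c" "\<And>i j. smooth_in c (\<lambda>r. M r $ i $ j)"
  shows "smooth_in c (\<lambda>r. det (M r))"
  unfolding det_def
  by (intro smooth_in_sum[OF assms(1)] smooth_in_mult[OF assms(1)] smooth_in_const
      smooth_in_prod[OF assms(1)] assms(2))

lemma smooth_in_ginv:
  assumes "is_chart X c" "\<And>i j. smooth_in c (\<lambda>r. g c r $ i $ j)"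
    and "\<And>r. r \<in> fst c \<Longrightarrow> lorentzian_form (g c r)"
  shows "smooth_in c (\<lambda>r. ginv g c r $ i $ j)"
proof (rule smooth_in_cong[OF assms(1)])
  let ?M = "\<lambda>r. \<chi> a b. if b = i then axis j 1 $ a else g c r $ a $ b"
  have M: "smooth_in c (\<lambda>r. ?M r $ a $ b)" for a b
    using assms(2) by (cases "b = i") (simp_all add: smooth_in_const)
  then show "smooth_in c (\<lambda>r. det (?M r) * inverse (det (g c r)))"
    by (intro smooth_in_mult[OF assms(1) smooth_in_det[OF assms(1) M]]
        smooth_in_inverse[OF assms(1) smooth_in_det[OF assms(1) assms(2)]] lorentzian_form_det assms(3))
  show "det (?M r) * inverse (det (g c r)) = ginv g c r $ i $ j" if "r \<in> fst c" for r
    unfolding ginv_def by (rule matrix_inv_cramer[OF lorentzian_form_det[OF assms(3)[OF that]], symmetric])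
qed

section \<open>Curvature of a Lorentzian metric in a chart\<close>

text \<open>The curvature identities are computations in a single chart, so the locale records what
  a spacetime supplies there.\<close>

locale lorentzian_chart =
  fixes X :: "'a topology" and c :: "'a chart" and g :: "'a chart \<Rightarrow> 'a \<Rightarrow> real^4^4"
  assumes chart: "is_chart X c"
    and smooth_metric: "smooth_in c (\<lambda>r. g c r $ i $ j)"
    and lorentzian: "r \<in> fst c \<Longrightarrow> lorentzian_form (g c r)"
begin

abbreviation "D \<equiv> pderiv_in c"
abbreviation "\<Gamma> \<equiv> christoffel g c"

lemma metric_sym: "q \<in> fst c \<Longrightarrow> g c q $ i $ j = g c q $ j $ i"
  using lorentzian[of q] unfolding lorentzian_form_def transpose_def
  by (metis (no_types, lifting) vec_lambda_beta)

lemma ginv_metric: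
  assumes "q \<in> fst c"
  shows "(\<Sum>k\<in>UNIV. ginv g c q $ i $ k * g c q $ k $ j) = of_bool (i = j)"
  using arg_cong[OF matrix_inv_inverse(2)[OF lorentzian_form_det[OF lorentzian[OF assms]]], of "\<lambda>M. M $ i $ j"]
  by (simp add: ginv_def matrix_matrix_mult_def mat_def)

lemma metric_ginv:
  assumes "q \<in> fst c"
  shows "(\<Sum>k\<in>UNIV. g c q $ i $ k * ginv g c q $ k $ j) = of_bool (i = j)"
  using arg_cong[OF matrix_inv_inverse(1)[OF lorentzian_form_det[OF lorentzian[OF assms]]], of "\<lambda>M. M $ i $ j"]
  by (simp add: ginv_def matrix_matrix_mult_def mat_def)

text \<open>Raising an index and lowering it again cancels; the nested form matches the sums that
  arise from unfolding the curvature definitions.\<close>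

lemma metric_ginv_contract:
  assumes "q \<in> fst c"
  shows "(\<Sum>k\<in>UNIV. g c q $ h $ k * (\<Sum>l\<in>UNIV. ginv g c q $ k $ l * v l)) = v h"
proof -
  have "(\<Sum>k\<in>UNIV. g c q $ h $ k * (\<Sum>l\<in>UNIV. ginv g c q $ k $ l * v l)) =
      (\<Sum>l\<in>UNIV. \<Sum>k\<in>UNIV. g c q $ h $ k * ginv g c q $ k $ l * v l)"
    by (subst sum.swap) (simp add: sum_distrib_left mult.assoc)
  also have "\<dots> = (\<Sum>l\<in>UNIV. of_bool (h = l) * v l)"
    by (simp add: sum_distrib_right[symmetric] metric_ginv[OF assms])
  also have "\<dots> = v h" by (simp add: of_bool_def if_distrib[of "\<lambda>a. a * _"] cong: if_cong)
  finally show ?thesis .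
qed

lemma ginv_metric_contract:
  assumes "q \<in> fst c"
  shows "(\<Sum>k\<in>UNIV. ginv g c q $ h $ k * (\<Sum>l\<in>UNIV. g c q $ k $ l * v l)) = v h"
proof -
  have "(\<Sum>k\<in>UNIV. ginv g c q $ h $ k * (\<Sum>l\<in>UNIV. g c q $ k $ l * v l)) =
      (\<Sum>l\<in>UNIV. \<Sum>k\<in>UNIV. ginv g c q $ h $ k * g c q $ k $ l * v l)"
    by (subst sum.swap) (simp add: sum_distrib_left mult.assoc)
  also have "\<dots> = (\<Sum>l\<in>UNIV. of_bool (h = l) * v l)"
    by (simp add: sum_distrib_right[symmetric] ginv_metric[OF assms])
  also have "\<dots> = v h" by (simp add: of_bool_def if_distrib[of "\<lambda>a. a * _"] cong: if_cong)
  finally show ?thesis .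
qed

lemmas smooth_add = smooth_in_add[OF chart]
  and smooth_mult = smooth_in_mult[OF chart]
  and smooth_diff = smooth_in_diff[OF chart]
  and smooth_sum = smooth_in_sum[OF chart]
  and smooth_D = smooth_in_pderiv_in[OF chart]
  and smooth_ginv = smooth_in_ginv[where g = g, OF chart smooth_metric lorentzian]

lemma smooth_christoffel: "smooth_in c (\<Gamma> k i j)"
  unfolding christoffel_def
  by (intro smooth_mult[OF smooth_in_const] smooth_sum smooth_mult[OF smooth_ginv]
      smooth_diff smooth_add smooth_D smooth_metric)

lemma smooth_riemann_up: "smooth_in c (riemann_up g c h i j k)"
  unfolding riemann_up_def
  by (intro smooth_add smooth_diff smooth_sum smooth_D smooth_mult smooth_christoffel)

lemma smooth_ricci_scalar: "smooth_in c (ricci_scalar g c)"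
  unfolding ricci_scalar_def ricci_def riemann_def
  by (intro smooth_sum smooth_mult[OF smooth_ginv] smooth_mult[OF smooth_metric] smooth_riemann_up)

section \<open>Christoffel symbols and the symmetries of the curvature\<close>

lemma D_metric_sym: "q \<in> fst c \<Longrightarrow> D k (\<lambda>r. g c r $ i $ j) q = D k (\<lambda>r. g c r $ j $ i) q"
  by (rule pderiv_in_cong[OF chart _ smooth_metric metric_sym])

lemma christoffel_sym:
  assumes "q \<in> fst c"
  shows "\<Gamma> k i j q = \<Gamma> k j i q"
  unfolding christoffel_def by (simp add: D_metric_sym[OF assms, of _ i j] algebra_simps)

lemma D_christoffel_sym: "q \<in> fst c \<Longrightarrow> D l (\<Gamma> k i j) q = D l (\<Gamma> k j i) q"
  by (rule pderiv_in_cong[OF chart _ smooth_christoffel christoffel_sym])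

text \<open>These are the Christoffel symbols of the first kind, with the lowered index in
  front.\<close>

definition christoffel_low :: "4 \<Rightarrow> 4 \<Rightarrow> 4 \<Rightarrow> 'a \<Rightarrow> real" where
  "christoffel_low h i j q = (\<Sum>k\<in>UNIV. g c q $ h $ k * \<Gamma> k i j q)"

lemma christoffel_low_eq:
  assumes "q \<in> fst c"
  shows "christoffel_low h i j q =
    (1/2) * (D i (\<lambda>r. g c r $ j $ h) q + D j (\<lambda>r. g c r $ i $ h) q - D h (\<lambda>r. g c r $ i $ j) q)"
proof -
  have "christoffel_low h i j q = (1/2) * (\<Sum>k\<in>UNIV. g c q $ h $ k * (\<Sum>l\<in>UNIV. ginv g c q $ k $ l *
      (D i (\<lambda>r. g c r $ j $ l) q + D j (\<lambda>r. g c r $ i $ l) q - D l (\<lambda>r. g c r $ i $ j) q)))"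
    unfolding christoffel_low_def christoffel_def by (simp add: sum_distrib_left mult.assoc mult.left_commute)
  then show ?thesis unfolding metric_ginv_contract[OF assms] .
qed

text \<open>This is the vanishing of the covariant derivative of \<open>g\<close>. In the sum of the
  two symbols the derivatives along \<open>i\<close> and \<open>j\<close> cancel, and two halves of
  the derivative along \<open>k\<close> remain.\<close>

lemma metric_compatible:
  assumes "q \<in> fst c"
  shows "D k (\<lambda>r. g c r $ i $ j) q = christoffel_low i k j q + christoffel_low j k i q"
  unfolding christoffel_low_eq[OF assms]
  using D_metric_sym[OF assms, of k i j] D_metric_sym[OF assms, of i j k] D_metric_sym[OF assms, of j i k]
  by (simp add: field_simps)

text \<open>Differentiating metric compatibility once more expresses the second derivatives of
  \<open>g\<close> through a part \<open>A\<close> symmetrized in \<open>h\<close>,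
  \<open>i\<close>. As these derivatives commute, the contributions of \<open>A\<close> to the sum
  of the two curvature components cancel, and those of the quadratic remainder \<open>C\<close>
  cancel by its pair symmetry.\<close>

lemma riemann_antisym:
  assumes q: "q \<in> fst c"
  shows "riemann g c h i j k q = - riemann g c i h j k q"
proof -
  \<comment> \<open>\<open>A j k h i\<close> is the derivative along \<open>j\<close> of
    \<open>christoffel_low h k i\<close>, expanded by the product rule.\<close>
  define A where "A j k h i = (\<Sum>m\<in>UNIV. g c q $ h $ m * D j (\<Gamma> m k i) q)
      + (\<Sum>m\<in>UNIV. D j (\<lambda>r. g c r $ h $ m) q * \<Gamma> m k i q)" for j k h i
  define C where "C j h k i = (\<Sum>m\<in>UNIV. christoffel_low m j h q * \<Gamma> m k i q)" for j h k i
  have DD: "D j (D k (\<lambda>r. g c r $ h $ i)) q = A j k h i + A j k i h" for j k h i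
  proof -
    have s: "smooth_in c (\<lambda>r. g c r $ a $ m * \<Gamma> m k b r)" for a b m
      by (rule smooth_mult[OF smooth_metric smooth_christoffel])
    have "D j (christoffel_low h k i) q = A j k h i" for h i
      unfolding christoffel_low_def A_def pderiv_in_sum[OF chart q s]
        pderiv_in_mult[OF chart q smooth_metric smooth_christoffel] by (rule sum.distrib)
    moreover have "D j (D k (\<lambda>r. g c r $ h $ i)) q =
        D j (\<lambda>r. christoffel_low h k i r + christoffel_low i k h r) q"
      by (rule pderiv_in_cong[OF chart q smooth_D[OF smooth_metric] metric_compatible])
    moreover have "\<dots> = D j (christoffel_low h k i) q + D j (christoffel_low i k h) q"
      unfolding christoffel_low_def by (intro pderiv_in_add[OF q] smooth_sum s)
    ultimately show ?thesis by simp
  qed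
  have sym: "C j h k i = C k i j h" for j h k i
    unfolding C_def christoffel_low_def sum_distrib_right
    by (subst sum.swap) (simp add: metric_sym[OF q] mult.commute mult.left_commute)
  define B where "B j k h i = (\<Sum>m\<in>UNIV. g c q $ h $ m * (\<Sum>n\<in>UNIV. \<Gamma> m j n q * \<Gamma> n k i q))" for j k h i
  \<comment> \<open>Metric compatibility splits the derivative of \<open>g\<close> inside
    \<open>A\<close>: one half gives \<open>B\<close>, the quadratic term of the curvature with its
    upper index lowered, the other half gives \<open>C\<close>.\<close>
  have A: "A j k h i = (\<Sum>m\<in>UNIV. g c q $ h $ m * D j (\<Gamma> m k i) q) + B j k h i + C j h k i" for j k h i
  proof -
    have "(\<Sum>m\<in>UNIV. christoffel_low h j m q * \<Gamma> m k i q) = B j k h i"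
      unfolding christoffel_low_def B_def sum_distrib_right sum_distrib_left
      by (subst sum.swap) (simp add: mult.assoc)
    then show ?thesis
      unfolding A_def C_def metric_compatible[OF q] by (simp add: distrib_right sum.distrib)
  qed
  have R: "riemann g c h i j k q = A j k h i - A k j h i - C j h k i + C k h j i" for h i
    unfolding A riemann_def riemann_up_def B_def
      D_christoffel_sym[OF q, of _ _ i] christoffel_sym[OF q, of _ i]
    by (simp add: algebra_simps sum.distrib sum_subtractf)
  have "A j k h i + A j k i h = A k j h i + A k j i h"
    using DD pderiv_in_commute[OF chart q smooth_metric] by metis
  then show ?thesis
    unfolding R[of h i] R[of i h] using sym[of j h k i] sym[of k h j i] by simp
qed

text \<open>The covariant derivative of \<open>R\<^sup>h\<^sub>i\<^sub>j\<^sub>k\<close> without the terms that correct the indices \<open>j\<close>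
  and \<open>k\<close>: these cancel in the cyclic sum.\<close>

definition nabla_riemann_up :: "4 \<Rightarrow> 4 \<Rightarrow> 4 \<Rightarrow> 4 \<Rightarrow> 4 \<Rightarrow> 'a \<Rightarrow> real" where
  "nabla_riemann_up l h i j k q = D l (riemann_up g c h i j k) q
     + (\<Sum>m\<in>UNIV. \<Gamma> h l m q * riemann_up g c m i j k q)
     - (\<Sum>m\<in>UNIV. riemann_up g c h m j k q * \<Gamma> m l i q)"

text \<open>Everything expands into second derivatives of \<Gamma>, products of \<Gamma> with its
  first derivatives (\<open>S\<close>, \<open>U\<close>) and triple products (\<open>V\<close>). In
  the cyclic sum the second derivatives cancel because partial derivatives commute; for each of
  \<open>S\<close>, \<open>U\<close> and \<open>V\<close>, every ordering of \<open>l\<close>,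
  \<open>j\<close>, \<open>k\<close> occurs once with each sign.\<close>

lemma second_bianchi:
  assumes q: "q \<in> fst c"
  shows "nabla_riemann_up l h i j k q + nabla_riemann_up j h i k l q + nabla_riemann_up k h i l j q = 0"
proof -
  define S where "S l j k = (\<Sum>m\<in>UNIV. \<Gamma> h j m q * D l (\<Gamma> m i k) q)" for l j k
  define U where "U l j k = (\<Sum>m\<in>UNIV. D l (\<Gamma> h j m) q * \<Gamma> m i k q)" for l j k
  define V where "V l j k = (\<Sum>m\<in>UNIV. \<Sum>n\<in>UNIV. \<Gamma> h l m q * \<Gamma> m j n q * \<Gamma> n i k q)" for l j k
  have 1: "D l (riemann_up g c h i j k) q = D l (D j (\<Gamma> h i k)) q - D l (D k (\<Gamma> h i j)) q
      + S l j k + U l j k - S l k j - U l k j" for l j k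
  proof -
    have s: "smooth_in c (\<lambda>r. \<Gamma> h j m r * \<Gamma> m i k r - \<Gamma> h k m r * \<Gamma> m i j r)" for m
      by (intro smooth_mult smooth_diff smooth_christoffel)
    have "D l (riemann_up g c h i j k) q = D l (\<lambda>r. D j (\<Gamma> h i k) r - D k (\<Gamma> h i j) r) q
        + D l (\<lambda>r. \<Sum>m\<in>UNIV. \<Gamma> h j m r * \<Gamma> m i k r - \<Gamma> h k m r * \<Gamma> m i j r) q"
      unfolding riemann_up_def
      by (rule pderiv_in_add[OF q]) (intro smooth_diff smooth_D smooth_christoffel smooth_sum s)+
    then show ?thesis
      unfolding pderiv_in_diff[OF chart q smooth_D[OF smooth_christoffel] smooth_D[OF smooth_christoffel]]
        pderiv_in_sum[OF chart q s] S_def U_def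
        pderiv_in_diff[OF chart q smooth_mult[OF smooth_christoffel smooth_christoffel]
          smooth_mult[OF smooth_christoffel smooth_christoffel]]
        pderiv_in_mult[OF chart q smooth_christoffel smooth_christoffel]
      by (simp add: sum.distrib sum_subtractf)
  qed
  have 2: "(\<Sum>m\<in>UNIV. \<Gamma> h l m q * riemann_up g c m i j k q) = S j l k - S k l j + V l j k - V l k j" for l j k
    unfolding riemann_up_def S_def V_def
    by (simp add: algebra_simps sum.distrib sum_subtractf sum_distrib_left)
  \<comment> \<open>Regrouping with the last factor outermost matches the term that corrects the
    index \<open>i\<close>.\<close>
  have V': "V j k l = (\<Sum>m\<in>UNIV. (\<Sum>n\<in>UNIV. \<Gamma> h j n q * \<Gamma> n m k q) * \<Gamma> m l i q)" for j k l
    unfolding V_def sum_distrib_right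
    by (subst sum.swap) (simp add: christoffel_sym[OF q, of _ k] christoffel_sym[OF q, of _ l])
  have 3: "(\<Sum>m\<in>UNIV. riemann_up g c h m j k q * \<Gamma> m l i q) = U j k l - U k j l + V j k l - V k j l" for l j k
    unfolding riemann_up_def U_def V' D_christoffel_sym[OF q, of _ h k] D_christoffel_sym[OF q, of _ h j]
      christoffel_sym[OF q, of _ i l]
    by (simp add: distrib_right left_diff_distrib sum.distrib sum_subtractf)
  show ?thesis
    unfolding nabla_riemann_up_def 1 2 3
    using pderiv_in_commute[OF chart q smooth_christoffel, of l j h i k]
      pderiv_in_commute[OF chart q smooth_christoffel, of l k h i j]
      pderiv_in_commute[OF chart q smooth_christoffel, of j k h i l]
    by simp
qed

section \<open>Projective flatness, constant curvature and Schur's lemma\<close>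

lemma ginv_metric_trace: "q \<in> fst c \<Longrightarrow> (\<Sum>h\<in>UNIV. \<Sum>j\<in>UNIV. ginv g c q $ h $ j * g c q $ j $ h) = 4"
  by (simp add: ginv_metric)

text \<open>With the Riemann tensor replaced by its Ricci expression, antisymmetry in
  \<open>h\<close>, \<open>i\<close> is a linear relation between Ricci components. Contracting it
  over \<open>h\<close> and \<open>j\<close> gives \<open>(4 - 1 + 1) R_ik = R g_ik\<close>.\<close>

lemma projectively_flat_imp_einstein:
  assumes q: "q \<in> fst c" and P: "\<And>h i j k. projective_curvature g c h i j k q = 0"
  shows "ricci g c i k q = ricci_scalar g c q / 4 * g c q $ i $ k"
proof -
  let ?g = "g c q" and ?H = "ginv g c q" and ?Ric = "\<lambda>i j. ricci g c i j q"
  have R: "riemann g c h i j k q = (1/3) * (?Ric i k * ?g $ j $ h - ?Ric i j * ?g $ h $ k)" for h i j k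
    using P[of h i j k] by (simp add: projective_curvature_def algebra_simps)
  have "?Ric i k * ?g $ j $ h - ?Ric i j * ?g $ h $ k + (?Ric h k * ?g $ j $ i - ?Ric h j * ?g $ i $ k) = 0" for h j
    using riemann_antisym[OF q, of h i j k] unfolding R by simp
  then have "0 = (\<Sum>h\<in>UNIV. \<Sum>j\<in>UNIV. ?H $ h $ j *
      (?Ric i k * ?g $ j $ h - ?Ric i j * ?g $ h $ k + (?Ric h k * ?g $ j $ i - ?Ric h j * ?g $ i $ k)))"
    by simp
  also have "\<dots> = ?Ric i k * (\<Sum>h\<in>UNIV. \<Sum>j\<in>UNIV. ?H $ h $ j * ?g $ j $ h)
      - (\<Sum>h\<in>UNIV. ?g $ k $ h * (\<Sum>j\<in>UNIV. ?H $ h $ j * ?Ric i j))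
      + (\<Sum>h\<in>UNIV. (\<Sum>j\<in>UNIV. ?H $ h $ j * ?g $ j $ i) * ?Ric h k)
      - ricci_scalar g c q * ?g $ i $ k"
    unfolding ricci_scalar_def
    by (simp add: distrib_left right_diff_distrib sum.distrib sum_subtractf sum_distrib_left sum_distrib_right
        metric_sym[OF q, of k] mult_ac)
  also have "(\<Sum>h\<in>UNIV. ?g $ k $ h * (\<Sum>j\<in>UNIV. ?H $ h $ j * ?Ric i j)) = ?Ric i k"
    by (rule metric_ginv_contract[OF q])
  also have "(\<Sum>h\<in>UNIV. (\<Sum>j\<in>UNIV. ?H $ h $ j * ?g $ j $ i) * ?Ric h k) = ?Ric i k"
    unfolding ginv_metric[OF q] by (simp add: of_bool_def if_distrib[of "\<lambda>a. a * _"] cong: if_cong)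
  finally show ?thesis unfolding ginv_metric_trace[OF q] by simp
qed

text \<open>The factor 1/12 is the 1/3 of the projective tensor times the 1/4 of the Einstein
  condition. Raising \<open>h\<close> turns two metric factors into Kronecker deltas.\<close>

lemma projectively_flat_riemann_up:
  assumes q: "q \<in> fst c" and P: "\<And>h i j k. projective_curvature g c h i j k q = 0"
  shows "riemann_up g c h i j k q =
    ricci_scalar g c q / 12 * (of_bool (h = j) * g c q $ i $ k - of_bool (h = k) * g c q $ i $ j)"
proof -
  let ?g = "g c q" and ?H = "ginv g c q" and ?K = "ricci_scalar g c q / 12"
  have R: "riemann g c h i j k q = ?K * (?g $ h $ j * ?g $ i $ k - ?g $ h $ k * ?g $ i $ j)" for h i j k
    using P[of h i j k] unfolding projective_curvature_def projectively_flat_imp_einstein[OF assms]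
    by (simp add: field_simps metric_sym[OF q, of j h])
  have "riemann_up g c h i j k q = (\<Sum>n\<in>UNIV. ?H $ h $ n * riemann g c n i j k q)"
    unfolding riemann_def ginv_metric_contract[OF q] ..
  also have "\<dots> = ?K * ((\<Sum>n\<in>UNIV. ?H $ h $ n * ?g $ n $ j) * ?g $ i $ k
      - (\<Sum>n\<in>UNIV. ?H $ h $ n * ?g $ n $ k) * ?g $ i $ j)"
    unfolding R by (simp add: right_diff_distrib sum_subtractf sum_distrib_left sum_distrib_right mult_ac)
  finally show ?thesis unfolding ginv_metric[OF q] .
qed

text \<open>In the second Bianchi identity the terms with undifferentiated \<open>K\<close> cancel
  by metric compatibility and the symmetry of \<Gamma>, which leaves a relation between derivatives
  of \<open>K\<close> alone.\<close>

lemma schur: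
  assumes K: "smooth_in c K"
    and R: "\<And>r h i j k. r \<in> fst c \<Longrightarrow> riemann_up g c h i j k r =
      K r * (of_bool (h = j) * g c r $ i $ k - of_bool (h = k) * g c r $ i $ j)"
    and q: "q \<in> fst c"
  shows "D l K q = 0"
proof -
  let ?g = "g c q" and ?H = "ginv g c q"
  have low_sym: "christoffel_low i j k q = christoffel_low i k j q" for i j k
    unfolding christoffel_low_def christoffel_sym[OF q, of _ j k] ..
  have delta: "(\<Sum>m\<in>UNIV. f m * (K q * (of_bool (m = j) * x - of_bool (m = k) * y))) = K q * (f j * x - f k * y)"
    for f :: "4 \<Rightarrow> real" and j k x y
    by (simp add: right_diff_distrib sum_subtractf of_bool_def if_distrib[of "\<lambda>a. a * _"]
        if_distrib[of "\<lambda>a. _ * a"] mult_ac cong: if_cong)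
  have N: "nabla_riemann_up l h i j k q = D l K q * (of_bool (h = j) * ?g $ i $ k - of_bool (h = k) * ?g $ i $ j)
      + K q * (of_bool (h = j) * christoffel_low i l k q - of_bool (h = k) * christoffel_low i l j q
        + \<Gamma> h l j q * ?g $ i $ k - \<Gamma> h l k q * ?g $ i $ j)" for l h i j k
  proof -
    have s: "smooth_in c (\<lambda>r. of_bool (h = j) * g c r $ i $ k - of_bool (h = k) * g c r $ i $ j)"
      by (intro smooth_diff smooth_mult[OF smooth_in_const] smooth_metric)
    have "D l (riemann_up g c h i j k) q =
        D l (\<lambda>r. K r * (of_bool (h = j) * g c r $ i $ k - of_bool (h = k) * g c r $ i $ j)) q"
      by (rule pderiv_in_cong[OF chart q smooth_riemann_up R])
    also have "\<dots> = K q * (of_bool (h = j) * D l (\<lambda>r. g c r $ i $ k) q - of_bool (h = k) * D l (\<lambda>r. g c r $ i $ j) q)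
        + D l K q * (of_bool (h = j) * ?g $ i $ k - of_bool (h = k) * ?g $ i $ j)"
      unfolding pderiv_in_mult[OF chart q K s]
        pderiv_in_diff[OF chart q smooth_mult[OF smooth_in_const smooth_metric] smooth_mult[OF smooth_in_const smooth_metric]]
        pderiv_in_mult[OF chart q smooth_in_const smooth_metric] pderiv_in_const by simp
    finally have 1: "D l (riemann_up g c h i j k) q = \<dots>" .
    have 2: "(\<Sum>m\<in>UNIV. \<Gamma> h l m q * riemann_up g c m i j k q) = K q * (\<Gamma> h l j q * ?g $ i $ k - \<Gamma> h l k q * ?g $ i $ j)"
      unfolding R[OF q] by (rule delta)
    have 3: "(\<Sum>m\<in>UNIV. riemann_up g c h m j k q * \<Gamma> m l i q) =
        K q * (of_bool (h = j) * christoffel_low k l i q - of_bool (h = k) * christoffel_low j l i q)"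
      unfolding R[OF q] christoffel_low_def metric_sym[OF q, of k] metric_sym[OF q, of j]
      by (simp add: right_diff_distrib left_diff_distrib sum_subtractf sum_distrib_left mult_ac)
    show ?thesis
      unfolding nabla_riemann_up_def 1 2 3 metric_compatible[OF q] by (simp add: algebra_simps)
  qed
  \<comment> \<open>Taking \<open>h = j\<close> different from \<open>l\<close> and \<open>k\<close>
    keeps just two derivative terms in the Bianchi identity. Three distinct indices exist because
    the dimension is at least 3.\<close>
  have "card (UNIV :: 4 set) = 4" by simp
  then obtain k :: 4 where k: "k \<noteq> l"
    using card_mono[of "{l}" "UNIV :: 4 set"] by force
  obtain j :: 4 where j: "j \<noteq> l" "j \<noteq> k"
    using card_mono[of "{l, k}" "UNIV :: 4 set"] card_insert_le_m1[of 2 "{k}" l] by force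
  have "D l K q * ?g $ i $ k = D k K q * ?g $ i $ l" for i
    using second_bianchi[OF q, of l j i j k] j k low_sym[of i l k] christoffel_sym[OF q, of j l k]
      christoffel_sym[OF q, of j l j] christoffel_sym[OF q, of j j k]
    unfolding N by (simp add: algebra_simps)
  \<comment> \<open>The sum is over \<open>i\<close> only, with \<open>k\<close> fixed: the left
    side acquires the delta of \<open>k\<close> with \<open>k\<close>, the right side that of
    \<open>k\<close> with \<open>l\<close>, which is 0.\<close>
  then have "(\<Sum>i\<in>UNIV. ?H $ k $ i * (D l K q * ?g $ i $ k)) = (\<Sum>i\<in>UNIV. ?H $ k $ i * (D k K q * ?g $ i $ l))"
    by simp
  then have "D l K q * (\<Sum>i\<in>UNIV. ?H $ k $ i * ?g $ i $ k) = D k K q * (\<Sum>i\<in>UNIV. ?H $ k $ i * ?g $ i $ l)"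
    by (simp add: sum_distrib_left mult_ac)
  then show ?thesis unfolding ginv_metric[OF q] using k by simp
qed

lemma projectively_flat_imp_ricci_scalar_stationary:
  assumes P: "\<And>r h i j k. r \<in> fst c \<Longrightarrow> projective_curvature g c h i j k r = 0"
    and q: "q \<in> fst c"
  shows "D i (ricci_scalar g c) q = 0"
proof -
  have "D i (\<lambda>r. (1/12) * ricci_scalar g c r) q = 0"
  proof (rule schur[OF smooth_mult[OF smooth_in_const smooth_ricci_scalar] _ q])
    fix r h i j k
    assume r: "r \<in> fst c"
    show "riemann_up g c h i j k r = (1/12) * ricci_scalar g c r *
        (of_bool (h = j) * g c r $ i $ k - of_bool (h = k) * g c r $ i $ j)"
      unfolding projectively_flat_riemann_up[OF r P[OF r]] by simp
  qed
  then show ?thesis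
    unfolding pderiv_in_mult[OF chart q smooth_in_const smooth_ricci_scalar] pderiv_in_const by simp
qed

end

section \<open>Projectively flat perfect fluids\<close>

theorem theorem2p1:
  fixes X :: "'a topology" and A :: "'a chart set"
    and g :: "'a chart \<Rightarrow> 'a \<Rightarrow> real^4^4"
    and u :: "'a chart \<Rightarrow> 'a \<Rightarrow> real^4"
    and p \<rho> :: "'a \<Rightarrow> real"
    and F :: "real \<Rightarrow> real" and \<kappa> :: real
  assumes "spacetime X A g"
    and "projectively_flat A g"
    and "smooth_on UNIV F"
    and "\<kappa> \<noteq> 0"
    and "smooth_scalar A p" and "smooth_scalar A \<rho>"
    and "unit_timelike_field A g u"
    and "FR_field_equations A g F \<kappa> (perfect_fluid g u p \<rho>)"
  shows "\<rho> constant_on topspace X \<and> p constant_on topspace X \<and>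
    (\<forall>c\<in>A. \<forall>q\<in>fst c.
       p q = ricci_scalar g c q * deriv F (ricci_scalar g c q) / (4 * \<kappa>\<^sup>2)
             - F (ricci_scalar g c q) / (2 * \<kappa>\<^sup>2) \<and>
       \<rho> q = F (ricci_scalar g c q) / (2 * \<kappa>\<^sup>2)
             - ricci_scalar g c q * deriv F (ricci_scalar g c q) / (4 * \<kappa>\<^sup>2))"
proof -
  have chart: "lorentzian_chart X c g" if "c \<in> A" for c
    using assms(1) that
    unfolding spacetime_def smooth_manifold4_def smooth_atlas_def lorentzian_metric_def
      covariant2_field_def lorentzian_chart_def by blast
  have is_chart: "is_chart X c" if "c \<in> A" for c
    by (rule lorentzian_chart.chart[OF chart[OF that]])
  have P: "projective_curvature g c h i j k q = 0" if "c \<in> A" "q \<in> fst c" for c q h i j k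
    using assms(2) that unfolding projectively_flat_def by blast
  have R_loc: "\<exists>B. open B \<and> snd c q \<in> B \<and>
      (\<forall>r\<in>fst c. snd c r \<in> B \<longrightarrow> ricci_scalar g c r = ricci_scalar g c q)"
    if c: "c \<in> A" and q: "q \<in> fst c" for c q
  proof -
    interpret lorentzian_chart X c g by (rule chart[OF c])
    have "pderiv_in c i (ricci_scalar g c) r = 0" if "r \<in> fst c" for r i
      by (rule projectively_flat_imp_ricci_scalar_stationary[OF P[OF c] that])
    then obtain B where "open B" "snd c q \<in> B"
      "\<And>r. r \<in> fst c \<Longrightarrow> snd c r \<in> B \<Longrightarrow> ricci_scalar g c r = ricci_scalar g c q"
      using pderiv_in_zero_imp_locally_const[OF is_chart[OF c] smooth_ricci_scalar _ q] by metis
    then show ?thesis by blast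
  qed
  have fluid: "p q = ricci_scalar g c q * deriv F (ricci_scalar g c q) / (4 * \<kappa>\<^sup>2)
             - F (ricci_scalar g c q) / (2 * \<kappa>\<^sup>2) \<and> \<rho> q = - p q"
    if c: "c \<in> A" and q: "q \<in> fst c" for c q
  proof -
    interpret lorentzian_chart X c g by (rule chart[OF c])
    let ?R = "ricci_scalar g c q" and ?g = "g c q" and ?f = "\<lambda>r. deriv F (ricci_scalar g c r)"
      and ?u = "\<lambda>i. lower g u c i q"
    \<comment> \<open>This is shown on the whole chart domain and not just at \<open>q\<close>,
      because it is differentiated again for the Hessian.\<close>
    have D1: "pderiv_in c k ?f r = 0" if r: "r \<in> fst c" for k r
    proof -
      obtain B where B: "open B" "snd c r \<in> B"
        "\<And>s. s \<in> fst c \<Longrightarrow> snd c s \<in> B \<Longrightarrow> ricci_scalar g c s = ricci_scalar g c r"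
        using R_loc[OF c r] by blast
      show ?thesis
        by (rule pderiv_in_locally_const[OF is_chart[OF c] B(1,2) r]) (simp only: B(3))
    qed
    have D2: "pderiv_in c i (pderiv_in c k ?f) q = 0" for i k
      by (rule pderiv_in_locally_const[OF is_chart[OF c] open_UNIV UNIV_I q D1])
    have nn: "nabla_nabla g c i j ?f q = 0" for i j
      unfolding nabla_nabla_def nabla_covector_def D2 D1[OF q] by simp
    \<comment> \<open>\<open>l\<close> is the factor of the metric that remains on the left of the
      field equations.\<close>
    define l where "l = ?R * deriv F ?R / 4 - F ?R / 2"
    have "deriv F ?R * ricci g c i j q - (1/2) * F ?R * ?g $ i $ j
        + (?g $ i $ j * box_op g c ?f q - nabla_nabla g c i j ?f q)
        = \<kappa>\<^sup>2 * perfect_fluid g u p \<rho> c i j q" for i j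
      using assms(8) c q unfolding FR_field_equations_def by blast
    then have eq: "l * ?g $ i $ j = \<kappa>\<^sup>2 * (p q * ?g $ i $ j + (p q + \<rho> q) * (?u i * ?u j))" for i j
      unfolding box_op_def nn projectively_flat_imp_einstein[OF q P[OF c q]] perfect_fluid_def l_def
      by (simp add: algebra_simps)
    have uu: "(\<Sum>i\<in>UNIV. ?u i * u c q $ i) = - 1"
      using assms(7) c q unfolding unit_timelike_field_def by blast
    \<comment> \<open>Contraction with \<open>u\<close> in the second index; the minus sign comes
      from the normalization of \<open>u\<close>. Contracting the first index as well then gives
      \<open>l = - (\<kappa>\<^sup>2 * \<rho> q)\<close>.\<close>
    have proj: "l * ?u i = \<kappa>\<^sup>2 * (p q * ?u i - (p q + \<rho> q) * ?u i)" for i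
    proof -
      have "l * ?u i = (\<Sum>j\<in>UNIV. l * ?g $ i $ j * u c q $ j)"
        by (simp add: lower_def sum_distrib_left mult.assoc)
      also have "\<dots> = \<kappa>\<^sup>2 * (p q * (\<Sum>j\<in>UNIV. ?g $ i $ j * u c q $ j)
          + (p q + \<rho> q) * ?u i * (\<Sum>j\<in>UNIV. ?u j * u c q $ j))"
        unfolding eq by (simp add: distrib_left distrib_right sum.distrib sum_distrib_left mult_ac)
      finally show ?thesis unfolding uu lower_def[symmetric] by simp
    qed
    have "l * (\<Sum>i\<in>UNIV. ?u i * u c q $ i) = \<kappa>\<^sup>2 * (p q - (p q + \<rho> q)) * (\<Sum>i\<in>UNIV. ?u i * u c q $ i)"
      unfolding sum_distrib_left mult.assoc[symmetric] proj by (simp add: algebra_simps)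
    then have l\<rho>: "l = - (\<kappa>\<^sup>2 * \<rho> q)" unfolding uu by simp
    have "(\<Sum>i\<in>UNIV. \<Sum>j\<in>UNIV. ginv g c q $ i $ j * (l * ?g $ j $ i)) =
        (\<Sum>i\<in>UNIV. \<Sum>j\<in>UNIV. ginv g c q $ i $ j * (\<kappa>\<^sup>2 * (p q * ?g $ j $ i + (p q + \<rho> q) * (?u j * ?u i))))"
      unfolding eq ..
    also have "\<dots> = \<kappa>\<^sup>2 * (p q * (\<Sum>i\<in>UNIV. \<Sum>j\<in>UNIV. ginv g c q $ i $ j * ?g $ j $ i)
        + (p q + \<rho> q) * (\<Sum>i\<in>UNIV. (\<Sum>j\<in>UNIV. ginv g c q $ i $ j * ?u j) * ?u i))"
      by (simp add: distrib_left sum.distrib sum_distrib_left sum_distrib_right mult_ac)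
    also have "(\<Sum>i\<in>UNIV. (\<Sum>j\<in>UNIV. ginv g c q $ i $ j * ?u j) * ?u i) = - 1"
      using uu unfolding lower_def ginv_metric_contract[OF q] by (simp add: mult.commute)
    also have "(\<Sum>i\<in>UNIV. \<Sum>j\<in>UNIV. ginv g c q $ i $ j * (l * ?g $ j $ i)) =
        l * (\<Sum>i\<in>UNIV. \<Sum>j\<in>UNIV. ginv g c q $ i $ j * ?g $ j $ i)"
      by (simp add: sum_distrib_left mult_ac)
    finally have "4 * l = \<kappa>\<^sup>2 * (4 * p q - (p q + \<rho> q))"
      unfolding ginv_metric_trace[OF q] by simp
    \<comment> \<open>Inserting the value of \<open>l\<close> into the trace leaves three times this
      expression equal to 0.\<close>
    then have "\<kappa>\<^sup>2 * (p q + \<rho> q) = 0" using l\<rho> by algebra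
    then have "\<rho> q = - p q" using assms(4) by simp
    moreover from this have "p q = l / \<kappa>\<^sup>2" using l\<rho> assms(4) by simp
    ultimately show ?thesis unfolding l_def by (simp add: diff_divide_distrib)
  qed
  have loc: "\<exists>N. openin X N \<and> q \<in> N \<and> (\<forall>r\<in>N. p r = p q)" if "q \<in> topspace X" for q
  proof -
    have "topspace X = (\<Union>c\<in>A. fst c)"
      using assms(1) unfolding spacetime_def smooth_manifold4_def smooth_atlas_def by simp
    with that obtain c where c: "c \<in> A" "q \<in> fst c" by auto
    obtain B where B: "open B" "snd c q \<in> B"
      "\<And>r. r \<in> fst c \<Longrightarrow> snd c r \<in> B \<Longrightarrow> ricci_scalar g c r = ricci_scalar g c q"
      using R_loc[OF c] by blast
    \<comment> \<open>Within one chart the formula for \<open>p\<close> depends on the point only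
      through \<open>R\<close>, which is constant over \<open>B\<close>.\<close>
    have p: "p r = p q" if "r \<in> fst c" "snd c r \<in> B" for r
      using conjunct1[OF fluid[OF c(1) that(1)]] conjunct1[OF fluid[OF c]] unfolding B(3)[OF that]
      by (rule trans[OF _ sym])
    show ?thesis
    proof (intro exI conjI ballI)
      show "openin X {r \<in> fst c. snd c r \<in> B}"
        by (rule openin_chart_vimage[OF is_chart[OF c(1)] B(1)])
      show "q \<in> {r \<in> fst c. snd c r \<in> B}" using c(2) B(2) by simp
      show "p r = p q" if "r \<in> {r \<in> fst c. snd c r \<in> B}" for r
        by (rule p) (use that in simp_all)
    qed
  qed
  have "connected_space X" using assms(1) by (simp add: spacetime_def)
  then have p: "p constant_on topspace X"
    by (rule constant_on_connected_space) (rule loc)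
  have "\<rho> q = - p q" if "q \<in> topspace X" for q
    using assms(1) that fluid unfolding spacetime_def smooth_manifold4_def smooth_atlas_def by blast
  then have "\<rho> constant_on topspace X"
    using p unfolding constant_on_def by metis
  with p fluid show ?thesis by (simp add: algebra_simps)
qed

end
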